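(* Let $k\geq 1$ be an integer and let $G$ be a non-bipartite graph with $m\geq 2k+3$ edges and no isolated vertices which contains none of the cycles $C_3, C_5, \ldots, C_{2k+1}$ as a subgraph. Then $$q(G)\leq q\big(C_{2k+3}\bullet K_{1,m-2k-3}\big),$$ with equality if and only if $G\cong C_{2k+3}\bullet K_{1,m-2k-3}$.
   Context: All graphs are simple. For a graph $G$, $Q(G)=D(G)+A(G)$ is the signless Laplacian matrix, where $D(G)$ is the diagonal degree matrix and $A(G)$ the adjacency matrix; the $Q$-index $q(G)$ is the largest eigenvalue of $Q(G)$. $C_\ell$ denotes the cycle on $\ell$ vertices and $K_{1,s}$ the star with $s$ edges. The graph $C_{2k+3}\bullet K_{1,m-2k-3}$ is obtained by identifying one vertex of $C_{2k+3}$ with the central vertex of $K_{1,m-2k-3}$ (so it has $m$ edges; for $m=2k+3$ it is $C_{2k+3}$). *)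

theory Defs
  imports "Jordan_Normal_Form.Char_Poly" "HOL-Library.Countable_Set"
begin

record 'a ugraph =
  verts :: "'a set"
  edges :: "'a set set"

definition simple_graph :: "'a ugraph \<Rightarrow> bool" where
  "simple_graph G \<longleftrightarrow> finite (verts G) \<and>
     (\<forall>e\<in>edges G. \<exists>u\<in>verts G. \<exists>v\<in>verts G. u \<noteq> v \<and> e = {u, v})"

definition vdegree :: "'a ugraph \<Rightarrow> 'a \<Rightarrow> nat" where
  "vdegree G v = card {e \<in> edges G. v \<in> e}"

definition no_isolated_vertices :: "'a ugraph \<Rightarrow> bool" where
  "no_isolated_vertices G \<longleftrightarrow> (\<forall>v\<in>verts G. \<exists>e\<in>edges G. v \<in> e)"

definition bipartite_graph :: "'a ugraph \<Rightarrow> bool" where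
  "bipartite_graph G \<longleftrightarrow> (\<exists>X Y. X \<union> Y = verts G \<and> X \<inter> Y = {} \<and>
     (\<forall>e\<in>edges G. \<exists>x\<in>X. \<exists>y\<in>Y. e = {x, y}))"

text \<open>Containment as a (not necessarily induced) subgraph, up to isomorphism.\<close>

definition contains_subgraph :: "'a ugraph \<Rightarrow> 'b ugraph \<Rightarrow> bool" where
  "contains_subgraph G H \<longleftrightarrow> (\<exists>f. inj_on f (verts H) \<and> f ` verts H \<subseteq> verts G \<and>
     (\<forall>e\<in>edges H. f ` e \<in> edges G))"

definition graph_iso :: "'a ugraph \<Rightarrow> 'b ugraph \<Rightarrow> bool" where
  "graph_iso G H \<longleftrightarrow> (\<exists>f. bij_betw f (verts G) (verts H) \<and> (\<lambda>e. f ` e) ` edges G = edges H)"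

text \<open>This is a cycle in the sense of simple graphs only for \<open>l \<ge> 3\<close>.\<close>

definition cycle_graph :: "nat \<Rightarrow> nat ugraph" where
  "cycle_graph l = \<lparr>verts = {..<l}, edges = {{i, Suc i mod l} | i. i < l}\<rparr>"

definition star_graph :: "'a \<Rightarrow> 'a set \<Rightarrow> 'a ugraph" where
  "star_graph c L = \<lparr>verts = insert c L, edges = {{c, x} | x. x \<in> L}\<rparr>"

text \<open>The cycle on \<open>{..<l}\<close> and the star with centre \<open>0\<close> and leaves \<open>{l..<l + s}\<close> share exactly
  the vertex \<open>0\<close>, so their union is the cycle and the star glued at that vertex.\<close>

definition cycle_star :: "nat \<Rightarrow> nat \<Rightarrow> nat ugraph" where
  "cycle_star l s =
     \<lparr>verts = verts (cycle_graph l) \<union> verts (star_graph 0 {l..<l + s}),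
      edges = edges (cycle_graph l) \<union> edges (star_graph 0 {l..<l + s})\<rparr>"

text \<open>Rows and columns follow the enumeration \<^term>\<open>from_nat_into (verts G)\<close>, which on a finite
  vertex set is a bijection from \<^term>\<open>{..<card (verts G)}\<close>. Another enumeration conjugates the
  matrices by a permutation matrix and so leaves the spectrum unchanged.\<close>

definition degree_matrix :: "'a ugraph \<Rightarrow> real mat" where
  "degree_matrix G = mat (card (verts G)) (card (verts G))
     (\<lambda>(i, j). if i = j then real (vdegree G (from_nat_into (verts G) i)) else 0)"

definition adjacency_matrix :: "'a ugraph \<Rightarrow> real mat" where
  "adjacency_matrix G = mat (card (verts G)) (card (verts G))
     (\<lambda>(i, j). if i \<noteq> j \<and> {from_nat_into (verts G) i, from_nat_into (verts G) j} \<in> edges G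
               then 1 else 0)"

definition signless_laplacian :: "'a ugraph \<Rightarrow> real mat" where
  "signless_laplacian G = degree_matrix G + adjacency_matrix G"

text \<open>The matrix is real symmetric, so all its eigenvalues are real.\<close>

definition q_index :: "'a ugraph \<Rightarrow> real" where
  "q_index G = Max {x. eigenvalue (signless_laplacian G) x}"

end

theory Submission
  imports Defs "HOL-Analysis.Function_Topology"
begin

text \<open>Write \<open>l = 2k + 3\<close> and \<open>s = m - l\<close>. The edge sums \<open>x u + x v\<close> of an eigenfunction \<open>x\<close> show that
  \<open>q(G) \<le> d(u) + d(v)\<close> for some edge \<open>uv\<close>. A shortest odd cycle of \<open>G\<close> is chordless and has length
  \<open>g \<ge> l\<close>; at most three of its edges meet \<open>{u, v}\<close>, so \<open>d(u) + d(v) \<le> m - g + 4\<close>. A test vector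
  gives \<open>q(C\<^sub>l \<bullet> K\<^sub>1\<^sub>,\<^sub>s) > s + 3\<close>. Hence if \<open>q(G)\<close> is at least this value, then \<open>g = l\<close>, the vertices
  \<open>u, v\<close> are adjacent on the cycle and every further edge is pendant at \<open>u\<close> or \<open>v\<close>. Finally, moving
  all pendant edges to the end with the larger Perron entry strictly increases \<open>q\<close> unless they are
  all there already.\<close>

section \<open>The signless Laplacian as a quadratic form\<close>

definition incident_edges :: "'a ugraph \<Rightarrow> 'a \<Rightarrow> 'a set set" where
  "incident_edges G v = {e \<in> edges G. v \<in> e}"

text \<open>On a simple graph this is the quadratic form of \<open>Q\<close>: each edge
  \<open>{u, v}\<close> contributes \<open>(x u + x v)\<close> squared.\<close>

definition q_form :: "'a ugraph \<Rightarrow> ('a \<Rightarrow> real) \<Rightarrow> real" where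
  "q_form G x = (\<Sum>e\<in>edges G. (sum x e)\<^sup>2)"

definition norm_sq :: "'a ugraph \<Rightarrow> ('a \<Rightarrow> real) \<Rightarrow> real" where
  "norm_sq G x = (\<Sum>v\<in>verts G. (x v)\<^sup>2)"

definition q_eigenfunction :: "'a ugraph \<Rightarrow> real \<Rightarrow> ('a \<Rightarrow> real) \<Rightarrow> bool" where
  "q_eigenfunction G c x \<longleftrightarrow> (\<forall>v\<in>verts G. (\<Sum>e\<in>incident_edges G v. sum x e) = c * x v)"

lemma simple_graph_edgeD:
  assumes "simple_graph G" "e \<in> edges G"
  obtains u v where "u \<in> verts G" "v \<in> verts G" "u \<noteq> v" "e = {u, v}"
  using assms unfolding simple_graph_def by blast

lemma simple_graph_edge_subset: "simple_graph G \<Longrightarrow> e \<in> edges G \<Longrightarrow> e \<subseteq> verts G"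
  by (metis simple_graph_edgeD insert_subset empty_subsetI)

lemma simple_graph_finite_verts: "simple_graph G \<Longrightarrow> finite (verts G)"
  by (simp add: simple_graph_def)

lemma simple_graph_finite_edges: "simple_graph G \<Longrightarrow> finite (edges G)"
  by (rule finite_subset[of _ "Pow (verts G)"])
    (auto dest: simple_graph_edge_subset simp: simple_graph_finite_verts)

lemma simple_graph_adjacent:
  assumes "simple_graph G" "{u, v} \<in> edges G"
  shows "u \<noteq> v" "u \<in> verts G" "v \<in> verts G"
proof -
  obtain a b where "a \<in> verts G" "b \<in> verts G" "a \<noteq> b" "{u, v} = {a, b}"
    using simple_graph_edgeD[OF assms] .
  then show "u \<noteq> v" "u \<in> verts G" "v \<in> verts G" by (auto simp: doubleton_eq_iff)
qed

lemma finite_incident_edges: "simple_graph G \<Longrightarrow> finite (incident_edges G v)"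
  by (simp add: incident_edges_def simple_graph_finite_edges)

lemma card_incident_edges: "card (incident_edges G v) = vdegree G v"
  by (simp add: incident_edges_def vdegree_def)

lemma incident_edges_eq_image:
  assumes "simple_graph G"
  shows "incident_edges G v = (\<lambda>z. {v, z}) ` {z \<in> verts G. {v, z} \<in> edges G}"
proof
  show "incident_edges G v \<subseteq> (\<lambda>z. {v, z}) ` {z \<in> verts G. {v, z} \<in> edges G}"
  proof
    fix e assume "e \<in> incident_edges G v"
    then have e: "e \<in> edges G" "v \<in> e" by (auto simp: incident_edges_def)
    then obtain a b where "a \<in> verts G" "b \<in> verts G" "e = {a, b}"
      using simple_graph_edgeD[OF assms] by metis
    with e show "e \<in> (\<lambda>z. {v, z}) ` {z \<in> verts G. {v, z} \<in> edges G}"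
      by (auto simp: insert_commute)
  qed
qed (auto simp: incident_edges_def)

lemma inj_on_doubleton: "inj_on (\<lambda>z. {v, z}) A"
  by (auto simp: inj_on_def doubleton_eq_iff)

text \<open>Each edge at \<open>v\<close> contributes \<open>x v\<close> once and the value at its
  other end once, which gives the row of \<open>D + A\<close> at \<open>v\<close>.\<close>

lemma sum_incident_edges:
  fixes x :: "'a \<Rightarrow> real"
  assumes "simple_graph G"
  shows "(\<Sum>e\<in>incident_edges G v. sum x e) =
    real (vdegree G v) * x v + (\<Sum>z | z \<in> verts G \<and> {v, z} \<in> edges G. x z)"
proof -
  let ?N = "{z \<in> verts G. {v, z} \<in> edges G}"
  have "(\<Sum>e\<in>incident_edges G v. sum x e) = (\<Sum>z\<in>?N. sum x {v, z})"
    by (simp add: incident_edges_eq_image[OF assms] sum.reindex[OF inj_on_doubleton])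
  also have "\<dots> = (\<Sum>z\<in>?N. x v + x z)"
    by (rule sum.cong) (auto dest: simple_graph_adjacent(1)[OF assms])
  also have "\<dots> = real (card ?N) * x v + (\<Sum>z\<in>?N. x z)"
    by (simp add: sum.distrib)
  also have "card ?N = vdegree G v"
    unfolding card_incident_edges[symmetric] incident_edges_eq_image[OF assms]
    by (simp add: card_image[OF inj_on_doubleton])
  finally show ?thesis .
qed

section \<open>Matrix eigenvalues as eigenfunctions on the vertices\<close>

lemma signless_laplacian_carrier:
  "signless_laplacian G \<in> carrier_mat (card (verts G)) (card (verts G))"
  by (simp add: signless_laplacian_def degree_matrix_def adjacency_matrix_def)

lemma signless_laplacian_mult_vec:
  fixes x :: "'a \<Rightarrow> real"
  assumes G: "simple_graph G" and i: "i < card (verts G)"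
  shows "(signless_laplacian G *\<^sub>v vec (card (verts G)) (\<lambda>j. x (from_nat_into (verts G) j))) $ i
    = (\<Sum>e\<in>incident_edges G (from_nat_into (verts G) i). sum x e)"
proof -
  let ?n = "card (verts G)" and ?b = "from_nat_into (verts G)"
  let ?v = "?b i"
  have bij: "bij_betw ?b {..<?n} (verts G)"
    using G by (simp add: bij_betw_from_nat_into_finite simple_graph_finite_verts)
  \<comment> \<open>For \<open>j = i\<close> the pair \<open>{?v, ?b j}\<close> collapses to a
    singleton, which is never an edge; this matches the zero diagonal of the adjacency
    matrix.\<close>
  have no_loop: "{a} \<notin> edges G" for a
    using simple_graph_adjacent(1)[OF G, of a a] by auto
  have "(signless_laplacian G *\<^sub>v vec ?n (\<lambda>j. x (?b j))) $ i =
    (\<Sum>j<?n. (if i = j then real (vdegree G ?v) * x (?b j) else 0) +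
       (if {?v, ?b j} \<in> edges G then x (?b j) else 0))"
    using i unfolding signless_laplacian_def degree_matrix_def adjacency_matrix_def
    by (auto simp: scalar_prod_def lessThan_atLeast0 no_loop intro!: sum.cong)
  also have "\<dots> = real (vdegree G ?v) * x ?v + (\<Sum>j<?n. if {?v, ?b j} \<in> edges G then x (?b j) else 0)"
    using i by (simp add: sum.distrib)
  also have "(\<Sum>j<?n. if {?v, ?b j} \<in> edges G then x (?b j) else 0) =
      (\<Sum>z\<in>verts G. if {?v, z} \<in> edges G then x z else 0)"
    by (rule sum.reindex_bij_betw[OF bij])
  also have "\<dots> = (\<Sum>z | z \<in> verts G \<and> {?v, z} \<in> edges G. x z)"
    using simple_graph_finite_verts[OF G] by (simp add: sum.inter_filter)
  finally show ?thesis by (simp add: sum_incident_edges[OF G])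
qed

text \<open>The passage from matrices to functions on vertices: \<open>key\<close> translates the
  eigenvector condition, and \<open>surj\<close> shows that every eigenvector is the list of values
  of some function. Afterwards the enumeration of the vertices no longer appears.\<close>

lemma eigenvalue_signless_laplacian_iff:
  assumes G: "simple_graph G"
  shows "eigenvalue (signless_laplacian G) c \<longleftrightarrow>
    (\<exists>x. q_eigenfunction G c x \<and> (\<exists>v\<in>verts G. x v \<noteq> 0))"
proof -
  let ?Q = "signless_laplacian G"
  let ?n = "card (verts G)" and ?b = "from_nat_into (verts G)"
  let ?vec = "\<lambda>x. vec ?n (\<lambda>j. x (?b j)) :: real vec"
  have bij: "bij_betw ?b {..<?n} (verts G)"
    using G by (simp add: bij_betw_from_nat_into_finite simple_graph_finite_verts)
  have dim: "dim_row ?Q = ?n" using signless_laplacian_carrier by blast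
  have ball_verts: "(\<forall>v\<in>verts G. P v) \<longleftrightarrow> (\<forall>i<?n. P (?b i))" for P
  proof -
    have "(\<forall>v\<in>?b ` {..<?n}. P v) \<longleftrightarrow> (\<forall>i<?n. P (?b i))" by auto
    then show ?thesis by (simp only: bij_betw_imp_surj_on[OF bij])
  qed
  have key: "eigenvector ?Q (?vec x) c \<longleftrightarrow> q_eigenfunction G c x \<and> (\<exists>v\<in>verts G. x v \<noteq> 0)" for x
  proof -
    have "?vec x \<noteq> 0\<^sub>v ?n \<longleftrightarrow> (\<exists>v\<in>verts G. x v \<noteq> 0)"
      using ball_verts[of "\<lambda>v. x v = 0"] by (auto simp: vec_eq_iff)
    moreover have "?Q *\<^sub>v ?vec x = c \<cdot>\<^sub>v ?vec x \<longleftrightarrow> q_eigenfunction G c x"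
    proof -
      have "?Q *\<^sub>v ?vec x = c \<cdot>\<^sub>v ?vec x \<longleftrightarrow>
          (\<forall>i<?n. (?Q *\<^sub>v ?vec x) $ i = c * x (?b i))"
        using dim by (auto simp: vec_eq_iff simp del: index_mult_mat_vec)
      also have "\<dots> \<longleftrightarrow> (\<forall>i<?n. (\<Sum>e\<in>incident_edges G (?b i). sum x e) = c * x (?b i))"
        by (simp add: signless_laplacian_mult_vec[OF G] del: index_mult_mat_vec)
      also have "\<dots> \<longleftrightarrow> q_eigenfunction G c x"
        by (simp add: q_eigenfunction_def ball_verts)
      finally show ?thesis .
    qed
    ultimately show ?thesis by (auto simp: eigenvector_def dim)
  qed
  have surj: "\<exists>x. w = ?vec x" if "eigenvector ?Q w c" for w
  proof -
    have w: "w \<in> carrier_vec ?n" using that by (simp add: eigenvector_def dim)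
    have "?vec (\<lambda>v. w $ the_inv_into {..<?n} ?b v) = w"
      using w bij by (auto simp: vec_eq_iff bij_betw_def the_inv_into_f_f)
    from this[symmetric] show ?thesis
      by (intro exI[of _ "\<lambda>v. w $ the_inv_into {..<?n} ?b v"])
  qed
  show ?thesis
  proof
    assume "eigenvalue ?Q c"
    then obtain w where w: "eigenvector ?Q w c" by (auto simp: eigenvalue_def)
    from surj[OF w] obtain x where "w = ?vec x" ..
    with w key show "\<exists>x. q_eigenfunction G c x \<and> (\<exists>v\<in>verts G. x v \<noteq> 0)" by blast
  next
    assume "\<exists>x. q_eigenfunction G c x \<and> (\<exists>v\<in>verts G. x v \<noteq> 0)"
    with key show "eigenvalue ?Q c" unfolding eigenvalue_def by blast
  qed
qed

text \<open>Eigenvalues are roots of the characteristic polynomial, which is monic and hence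
  nonzero. Finiteness is what gives \<open>Max\<close> in \<open>q_index\<close> its
  meaning.\<close>

lemma finite_eigenvalues_signless_laplacian: "finite {c. eigenvalue (signless_laplacian G) c}"
proof -
  have "char_poly (signless_laplacian G) \<noteq> 0"
    using degree_monic_char_poly[OF signless_laplacian_carrier[of G]] by auto
  then show ?thesis
    unfolding eigenvalue_root_char_poly[OF signless_laplacian_carrier]
    by (rule poly_roots_finite)
qed

text \<open>Double counting of the pairs of a vertex and an edge through it. The right side is the
  symmetric bilinear form of \<open>Q\<close>, whose diagonal is \<open>q_form\<close>.\<close>

lemma sum_mult_incident_edges:
  fixes x y :: "'a \<Rightarrow> real"
  assumes G: "simple_graph G"
  shows "(\<Sum>v\<in>verts G. y v * (\<Sum>e\<in>incident_edges G v. sum x e)) = (\<Sum>e\<in>edges G. sum y e * sum x e)"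
proof -
  have "(\<Sum>v\<in>verts G. y v * (\<Sum>e\<in>incident_edges G v. sum x e)) =
      (\<Sum>v\<in>verts G. \<Sum>e | e \<in> edges G \<and> v \<in> e. y v * sum x e)"
    unfolding incident_edges_def by (rule sum.cong[OF refl]) (rule sum_distrib_left)
  also have "\<dots> = (\<Sum>e\<in>edges G. \<Sum>v | v \<in> verts G \<and> v \<in> e. y v * sum x e)"
    by (rule sum.swap_restrict)
      (simp_all add: G simple_graph_finite_verts simple_graph_finite_edges)
  also have "\<dots> = (\<Sum>e\<in>edges G. sum y e * sum x e)"
  proof (rule sum.cong[OF refl])
    fix e assume "e \<in> edges G"
    then have "{v \<in> verts G. v \<in> e} = e" using simple_graph_edge_subset[OF G] by blast
    then show "(\<Sum>v | v \<in> verts G \<and> v \<in> e. y v * sum x e) = sum y e * sum x e"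
      by (simp add: sum_distrib_right)
  qed
  finally show ?thesis .
qed

lemma q_form_eigenfunction:
  assumes "simple_graph G" "q_eigenfunction G c x"
  shows "q_form G x = c * norm_sq G x"
proof -
  have "q_form G x = (\<Sum>v\<in>verts G. x v * (\<Sum>e\<in>incident_edges G v. sum x e))"
    by (simp add: sum_mult_incident_edges[OF assms(1)] q_form_def power2_eq_square)
  also have "\<dots> = (\<Sum>v\<in>verts G. x v * (c * x v))"
    using assms(2) by (simp add: q_eigenfunction_def)
  also have "\<dots> = c * norm_sq G x"
    by (simp add: norm_sq_def sum_distrib_left power2_eq_square mult_ac)
  finally show ?thesis .
qed

section \<open>Variational characterisation of the Q-index\<close>

lemma norm_sq_nonneg: "norm_sq G x \<ge> 0"
  by (simp add: norm_sq_def sum_nonneg)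

lemma norm_sq_pos_iff: "finite (verts G) \<Longrightarrow> norm_sq G x > 0 \<longleftrightarrow> (\<exists>v\<in>verts G. x v \<noteq> 0)"
  using norm_sq_nonneg[of G x] by (auto simp: norm_sq_def sum_nonneg_eq_0_iff less_le)

lemma q_form_cong: "simple_graph G \<Longrightarrow> (\<And>v. v \<in> verts G \<Longrightarrow> x v = y v) \<Longrightarrow> q_form G x = q_form G y"
  unfolding q_form_def
  by (intro sum.cong refl arg_cong[where f = "\<lambda>t. t\<^sup>2"]) (meson simple_graph_edge_subset subsetD)

lemma norm_sq_cong: "(\<And>v. v \<in> verts G \<Longrightarrow> x v = y v) \<Longrightarrow> norm_sq G x = norm_sq G y"
  by (simp add: norm_sq_def)

lemma q_form_scale: "q_form G (\<lambda>v. a * x v) = a\<^sup>2 * q_form G x"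
  by (simp add: q_form_def sum_distrib_left[symmetric] power_mult_distrib)

lemma norm_sq_scale: "norm_sq G (\<lambda>v. a * x v) = a\<^sup>2 * norm_sq G x"
  by (simp add: norm_sq_def sum_distrib_left[symmetric] power_mult_distrib)

text \<open>The form is continuous on the compact unit sphere, hence attains a maximum there;
  homogeneity extends the bound to all \<open>y\<close>.\<close>

lemma exists_q_form_maximiser:
  assumes G: "simple_graph G" and ne: "verts G \<noteq> {}"
  shows "\<exists>x. norm_sq G x = 1 \<and> (\<forall>y. q_form G y \<le> q_form G x * norm_sq G y)"
proof -
  \<comment> \<open>Functions are forced to vanish off \<open>verts G\<close>, so that the sphere is
    a closed subset of a product of compact sets in the function space.\<close>
  let ?K = "PiE UNIV (\<lambda>v. if v \<in> verts G then {-1..1} else {0}) :: ('a \<Rightarrow> real) set"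
  let ?S = "?K \<inter> {x. norm_sq G x = 1}"
  have fin: "finite (verts G)" using G by (rule simple_graph_finite_verts)
  have "compactin (product_topology (\<lambda>_. euclidean) UNIV) ?K"
    unfolding compactin_PiE by auto
  then have "compact ?K"
    by (simp add: euclidean_product_topology compactin_euclidean_iff)
  moreover have cont_norm: "continuous_on UNIV (norm_sq G)"
    unfolding norm_sq_def by (intro continuous_intros continuous_on_product_coordinates)
  have "closed {x. norm_sq G x = 1}"
    using cont_norm by (intro closed_Collect_eq) auto
  ultimately have "compact ?S" by (rule compact_Int_closed)
  moreover have "?S \<noteq> {}"
  proof -
    from ne obtain a where a: "a \<in> verts G" by blast
    have "norm_sq G (\<lambda>v. if v = a then 1 else 0) = (\<Sum>v\<in>verts G. if v = a then 1 else 0)"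
      unfolding norm_sq_def by (rule sum.cong) auto
    also have "\<dots> = 1" using a fin by simp
    finally have "(\<lambda>v. if v = a then 1 else 0) \<in> ?S" using a by auto
    then show ?thesis by blast
  qed
  moreover have "continuous_on ?S (q_form G)"
    unfolding q_form_def
    by (intro continuous_intros continuous_on_subset[OF continuous_on_product_coordinates]) auto
  ultimately obtain x where x: "x \<in> ?S" and max: "\<forall>y\<in>?S. q_form G y \<le> q_form G x"
    using continuous_attains_sup[of ?S "q_form G"] by blast
  have "q_form G y \<le> q_form G x * norm_sq G y" for y
  proof (cases "norm_sq G y = 0")
    case True
    then have "\<forall>v\<in>verts G. y v = 0"
      using norm_sq_pos_iff[OF fin, of y] by auto
    then have "q_form G y = q_form G (\<lambda>_. 0)"
      by (intro q_form_cong[OF G]) auto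
    then show ?thesis using True by (simp add: q_form_def)
  next
    case False
    then have pos: "norm_sq G y > 0" using norm_sq_nonneg[of G y] by linarith
    define a where "a = 1 / sqrt (norm_sq G y)"
    have a2: "a\<^sup>2 = 1 / norm_sq G y"
      using pos by (simp add: a_def power_divide)
    \<comment> \<open>Normalise \<open>y\<close> and cut it off outside \<open>verts G\<close>, so
      that it lies in \<open>?S\<close>; neither form sees the values outside.\<close>
    define z where "z v = (if v \<in> verts G then a * y v else 0)" for v
    have nz: "norm_sq G z = 1"
    proof -
      have "norm_sq G z = norm_sq G (\<lambda>v. a * y v)" by (rule norm_sq_cong) (simp add: z_def)
      then show ?thesis using pos by (simp add: norm_sq_scale a2)
    qed
    have "\<bar>z v\<bar> \<le> 1" if "v \<in> verts G" for v
    proof -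
      have "(z v)\<^sup>2 \<le> norm_sq G z"
        unfolding norm_sq_def using fin that by (intro member_le_sum) auto
      then show ?thesis by (simp add: nz abs_square_le_1)
    qed
    then have "z \<in> ?S" using nz by (auto simp: z_def abs_le_iff)
    then have "q_form G z \<le> q_form G x" using max by blast
    moreover have "q_form G z = q_form G y / norm_sq G y"
    proof -
      have "q_form G z = q_form G (\<lambda>v. a * y v)"
        by (rule q_form_cong[OF G]) (simp add: z_def)
      then show ?thesis by (simp add: q_form_scale a2)
    qed
    ultimately show ?thesis using pos by (simp add: divide_simps)
  qed
  with x show ?thesis by blast
qed

text \<open>For small \<open>t\<close> of sign opposite to \<open>b\<close> the linear term would
  dominate and make the expression negative.\<close>

lemma linear_coeff_zero_if_quadratic_nonneg:
  fixes a b :: real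
  assumes "\<And>t. 0 \<le> 2 * t * b + t\<^sup>2 * a"
  shows "b = 0"
proof (rule ccontr)
  assume b: "b \<noteq> 0"
  define s where "s = 1 / (\<bar>a\<bar> + 1)"
  have s: "s > 0" "s * a < 1" by (auto simp: s_def divide_simps)
  have "0 \<le> 2 * (- s * b) * b + (- s * b)\<^sup>2 * a" by (rule assms)
  also have "\<dots> = s * b\<^sup>2 * (s * a - 2)" by (simp add: power2_eq_square algebra_simps)
  also have "\<dots> < 0" using s b by (intro mult_pos_neg) auto
  finally show False by simp
qed

text \<open>\<^term>\<open>c * norm_sq G y - q_form G y\<close> is a positive semidefinite form in \<open>y\<close> vanishing at \<open>x\<close>, so
  its polar form vanishes at \<open>x\<close> too.\<close>

lemma maximiser_is_eigenfunction:
  assumes G: "simple_graph G"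
    and le: "\<And>y. q_form G y \<le> c * norm_sq G y" and eq: "q_form G x = c * norm_sq G x"
  shows "q_eigenfunction G c x"
  unfolding q_eigenfunction_def
proof
  fix v assume v: "v \<in> verts G"
  have fin: "finite (verts G)" using G by (rule simple_graph_finite_verts)
  \<comment> \<open>Perturb \<open>x\<close> in the direction of the unit vector \<open>h\<close> at
    \<open>v\<close>. The linear coefficient in \<open>t\<close> of
    \<open>c * norm_sq - q_form\<close> is then \<open>2 * b\<close>, with \<open>b\<close> the
    defect of the eigenvalue equation at \<open>v\<close>.\<close>
  define h :: "'a \<Rightarrow> real" where "h w = (if w = v then 1 else 0)" for w
  define b where "b = c * x v - (\<Sum>e\<in>incident_edges G v. sum x e)"
  have hx: "(\<Sum>w\<in>verts G. h w * f w) = f v" for f :: "'a \<Rightarrow> real"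
    using v fin by (simp add: h_def if_distrib[where f = "\<lambda>t. t * _"] cong: if_cong)
  have "0 \<le> 2 * t * b + t\<^sup>2 * (c * norm_sq G h - q_form G h)" for t
  proof -
    have "norm_sq G (\<lambda>w. x w + t * h w) =
        (\<Sum>w\<in>verts G. (x w)\<^sup>2 + 2 * t * (h w * x w) + t\<^sup>2 * (h w)\<^sup>2)"
      unfolding norm_sq_def by (rule sum.cong) (auto simp: power2_eq_square algebra_simps)
    also have "\<dots> = norm_sq G x + 2 * t * x v + t\<^sup>2 * norm_sq G h"
      by (simp add: norm_sq_def sum.distrib sum_distrib_left[symmetric] hx)
    finally have n: "norm_sq G (\<lambda>w. x w + t * h w) = norm_sq G x + 2 * t * x v + t\<^sup>2 * norm_sq G h" .
    have "q_form G (\<lambda>w. x w + t * h w) =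
        (\<Sum>e\<in>edges G. (sum x e)\<^sup>2 + 2 * t * (sum h e * sum x e) + t\<^sup>2 * (sum h e)\<^sup>2)"
      unfolding q_form_def
    proof (rule sum.cong[OF refl])
      fix e
      have "(\<Sum>w\<in>e. x w + t * h w) = sum x e + t * sum h e"
        by (simp add: sum.distrib sum_distrib_left)
      then show "(\<Sum>w\<in>e. x w + t * h w)\<^sup>2 =
          (sum x e)\<^sup>2 + 2 * t * (sum h e * sum x e) + t\<^sup>2 * (sum h e)\<^sup>2"
        by (simp add: power2_eq_square algebra_simps)
    qed
    also have "\<dots> = q_form G x + 2 * t * (\<Sum>e\<in>incident_edges G v. sum x e) + t\<^sup>2 * q_form G h"
      by (simp add: q_form_def sum.distrib sum_distrib_left[symmetric] sum_mult_incident_edges[OF G, symmetric] hx)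
    finally show ?thesis
      using le[of "\<lambda>w. x w + t * h w"] eq unfolding n b_def by (simp add: algebra_simps)
  qed
  then have "b = 0" by (rule linear_coeff_zero_if_quadratic_nonneg)
  then show "(\<Sum>e\<in>incident_edges G v. sum x e) = c * x v" by (simp add: b_def)
qed

text \<open>An attained upper bound of the Rayleigh quotient is an eigenvalue, and every eigenvalue
  is itself a value of that quotient.\<close>

lemma q_index_eq_maximum:
  assumes G: "simple_graph G" and x: "norm_sq G x > 0"
    and le: "\<And>y. q_form G y \<le> c * norm_sq G y" and eq: "q_form G x = c * norm_sq G x"
  shows "q_index G = c"
  unfolding q_index_def
proof (rule Max_eqI)
  note fin = simple_graph_finite_verts[OF G]
  show "finite {x. eigenvalue (signless_laplacian G) x}"
    by (rule finite_eigenvalues_signless_laplacian)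
  show "c \<in> {x. eigenvalue (signless_laplacian G) x}"
    using maximiser_is_eigenfunction[OF G le eq] x
    by (auto simp: eigenvalue_signless_laplacian_iff[OF G] norm_sq_pos_iff[OF fin])
  fix d assume "d \<in> {x. eigenvalue (signless_laplacian G) x}"
  then obtain y where "q_eigenfunction G d y" "norm_sq G y > 0"
    by (auto simp: eigenvalue_signless_laplacian_iff[OF G] norm_sq_pos_iff[OF fin])
  with le[of y] q_form_eigenfunction[OF G] show "d \<le> c" by auto
qed

text \<open>Passing to absolute values keeps the norm and decreases no squared edge sum, so some
  maximiser is nonnegative. It serves as Perron vector; its zeros are handled by
  \<open>eigenfunction_zero_spreads\<close>.\<close>

lemma
  assumes G: "simple_graph G" and ne: "verts G \<noteq> {}"
  shows q_form_le_q_index: "q_form G y \<le> q_index G * norm_sq G y"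
    and exists_nonneg_q_maximiser: "\<exists>x. (\<forall>v. x v \<ge> 0) \<and> norm_sq G x > 0 \<and> q_form G x = q_index G * norm_sq G x"
proof -
  obtain x where nx: "norm_sq G x = 1" and max: "\<And>y. q_form G y \<le> q_form G x * norm_sq G y"
    using exists_q_form_maximiser[OF G ne] by blast
  have q: "q_index G = q_form G x"
    using nx max by (intro q_index_eq_maximum[OF G, of x]) auto
  show le: "q_form G y \<le> q_index G * norm_sq G y" for y using max q by simp
  let ?x = "\<lambda>v. \<bar>x v\<bar>"
  have n: "norm_sq G ?x = 1" using nx by (simp add: norm_sq_def)
  have "q_form G x \<le> q_form G ?x"
    unfolding q_form_def
  proof (rule sum_mono)
    fix e
    have "\<bar>sum x e\<bar> \<le> \<bar>sum ?x e\<bar>" using sum_abs[of x e] by simp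
    then show "(sum x e)\<^sup>2 \<le> (sum ?x e)\<^sup>2" by (simp only: abs_le_square_iff)
  qed
  with le[of ?x] n q have "q_form G ?x = q_index G * norm_sq G ?x" by simp
  with n show "\<exists>x. (\<forall>v. x v \<ge> 0) \<and> norm_sq G x > 0 \<and> q_form G x = q_index G * norm_sq G x"
    by (intro exI[of _ ?x]) auto
qed

lemma q_index_maximiser_eigenfunction:
  assumes "simple_graph G" "verts G \<noteq> {}" "q_form G x = q_index G * norm_sq G x"
  shows "q_eigenfunction G (q_index G) x"
  using maximiser_is_eigenfunction[OF assms(1) q_form_le_q_index[OF assms(1,2)] assms(3)] .

section \<open>Invariance under isomorphism\<close>

lemma graph_iso_sym:
  assumes G: "simple_graph G" and iso: "graph_iso G H"
  shows "graph_iso H G"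
proof -
  obtain f where f: "bij_betw f (verts G) (verts H)" "(\<lambda>e. f ` e) ` edges G = edges H"
    using iso unfolding graph_iso_def by blast
  let ?g = "the_inv_into (verts G) f"
  have "?g ` f ` e = e" if "e \<in> edges G" for e
    using simple_graph_edge_subset[OF G that] f(1)
    by (force simp: image_image bij_betw_def the_inv_into_f_f)
  then have "(\<lambda>e. ?g ` e) ` edges H = edges G"
    unfolding f(2)[symmetric] by (simp add: image_image)
  moreover have "bij_betw ?g (verts H) (verts G)" using f(1) by (rule bij_betw_the_inv_into)
  ultimately show ?thesis unfolding graph_iso_def by blast
qed

lemma simple_graph_iso:
  assumes G: "simple_graph G" and iso: "graph_iso G H"
  shows "simple_graph H"
proof -
  obtain f where f: "bij_betw f (verts G) (verts H)" "(\<lambda>e. f ` e) ` edges G = edges H"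
    using iso unfolding graph_iso_def by blast
  have "finite (verts H)"
    using simple_graph_finite_verts[OF G] bij_betw_finite[OF f(1)] by simp
  moreover have "\<exists>u\<in>verts H. \<exists>v\<in>verts H. u \<noteq> v \<and> e = {u, v}" if "e \<in> edges H" for e
  proof -
    from that f(2) obtain e' where e': "e' \<in> edges G" "e = f ` e'" by blast
    obtain u v where "u \<in> verts G" "v \<in> verts G" "u \<noteq> v" "e' = {u, v}"
      using simple_graph_edgeD[OF G e'(1)] .
    with e' f(1) show ?thesis
      by (intro bexI[of _ "f u"] bexI[of _ "f v"]) (auto simp: bij_betw_def dest: inj_onD)
  qed
  ultimately show ?thesis by (simp add: simple_graph_def)
qed

lemma q_form_iso:
  assumes G: "simple_graph G" and f: "bij_betw f (verts G) (verts H)" "(\<lambda>e. f ` e) ` edges G = edges H"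
  shows "q_form G (y \<circ> f) = q_form H y" "norm_sq G (y \<circ> f) = norm_sq H y"
proof -
  have inj: "inj_on f (verts G)" using f(1) by (simp add: bij_betw_def)
  have "inj_on (\<lambda>e. f ` e) (edges G)"
    using inj_on_image_eq_iff[OF inj] simple_graph_edge_subset[OF G] by (auto simp: inj_on_def)
  then have "q_form H y = (\<Sum>e\<in>edges G. (sum y (f ` e))\<^sup>2)"
    by (simp add: q_form_def f(2)[symmetric] sum.reindex)
  also have "\<dots> = q_form G (y \<circ> f)"
    unfolding q_form_def
    by (intro sum.cong refl arg_cong[where f = "\<lambda>t. t\<^sup>2"])
      (metis G inj inj_on_subset simple_graph_edge_subset sum.reindex)
  finally show "q_form G (y \<circ> f) = q_form H y" by simp
  show "norm_sq G (y \<circ> f) = norm_sq H y"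
    unfolding norm_sq_def using sum.reindex_bij_betw[OF f(1), of "\<lambda>v. (y v)\<^sup>2"] by simp
qed

text \<open>Composition with the isomorphism preserves both forms, so a maximiser of
  \<open>H\<close> pulls back to one of \<open>G\<close>; test functions on \<open>G\<close> are
  carried to \<open>H\<close> by the inverse map.\<close>

lemma q_index_iso:
  assumes G: "simple_graph G" and ne: "verts G \<noteq> {}" and iso: "graph_iso G H"
  shows "q_index G = q_index H"
proof -
  obtain f where f: "bij_betw f (verts G) (verts H)" "(\<lambda>e. f ` e) ` edges G = edges H"
    using iso unfolding graph_iso_def by blast
  have H: "simple_graph H" using simple_graph_iso[OF G iso] .
  have neH: "verts H \<noteq> {}" using f(1) ne by (auto simp: bij_betw_def)
  obtain y where y: "norm_sq H y > 0" "q_form H y = q_index H * norm_sq H y"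
    using exists_nonneg_q_maximiser[OF H neH] by blast
  note q_form_iso = q_form_iso[OF G f]
  show ?thesis
  proof (rule q_index_eq_maximum[OF G, of "y \<circ> f"])
    show "q_form G z \<le> q_index H * norm_sq G z" for z
    proof -
      let ?z = "z \<circ> the_inv_into (verts G) f"
      have z: "(?z \<circ> f) v = z v" if "v \<in> verts G" for v
        using that f(1) by (simp add: bij_betw_def the_inv_into_f_f)
      have "q_form G z = q_form H ?z" "norm_sq G z = norm_sq H ?z"
        unfolding q_form_iso[symmetric] using z
        by (metis q_form_cong[OF G], metis norm_sq_cong)
      then show ?thesis using q_form_le_q_index[OF H neH] by simp
    qed
  qed (use y q_form_iso in auto)
qed

section \<open>Degree bound and zeros of eigenfunctions\<close>

text \<open>The edge function \<open>e \<mapsto> sum x e\<close> of an eigenfunction \<open>x\<close> is an eigenfunction of \<open>2I + A\<close> of the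
  line graph, whose row sums are the sums of the degrees of the ends of the edges.\<close>

lemma eigenvalue_le_edge_degree_sum:
  assumes G: "simple_graph G" and eig: "q_eigenfunction G c x" and nz: "\<exists>v\<in>verts G. x v \<noteq> 0"
    and c: "c > 0"
  obtains u v where "{u, v} \<in> edges G" "c \<le> real (vdegree G u + vdegree G v)"
proof -
  let ?y = "\<lambda>e. \<bar>sum x e\<bar>"
  note fin = simple_graph_finite_edges[OF G]
  obtain w where w: "w \<in> verts G" "x w \<noteq> 0" using nz by blast
  have cx: "(\<Sum>e\<in>incident_edges G v. sum x e) = c * x v" if "v \<in> verts G" for v
    using eig that by (simp add: q_eigenfunction_def)
  \<comment> \<open>The edge sums at \<open>w\<close> add up to \<open>c * x w\<close>, which is
    nonzero. Hence the largest absolute edge sum, chosen below, is positive.\<close>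
  have "\<exists>e\<in>incident_edges G w. sum x e \<noteq> 0"
    using cx[OF w(1)] w(2) c by (metis mult_eq_0_iff less_irrefl sum.neutral)
  then obtain e0 where e0: "e0 \<in> edges G" "?y e0 > 0"
    by (auto simp: incident_edges_def)
  have "Max (?y ` edges G) \<in> ?y ` edges G" using fin e0 by (intro Max_in) auto
  then obtain e where e: "e \<in> edges G" and "?y e = Max (?y ` edges G)" by force
  then have max: "?y e' \<le> ?y e" if "e' \<in> edges G" for e' using fin that by simp
  have pos: "?y e > 0" using max[OF e0(1)] e0(2) by linarith
  obtain u v where uv: "u \<in> verts G" "v \<in> verts G" "u \<noteq> v" "e = {u, v}"
    using simple_graph_edgeD[OF G e] .
  have bound: "\<bar>c * x z\<bar> \<le> real (vdegree G z) * ?y e" if "z \<in> verts G" for z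
  proof -
    have "\<bar>\<Sum>e'\<in>incident_edges G z. sum x e'\<bar> \<le> (\<Sum>e'\<in>incident_edges G z. ?y e')"
      by (rule sum_abs)
    also have "\<dots> \<le> (\<Sum>e'\<in>incident_edges G z. ?y e)"
      using max by (intro sum_mono) (auto simp: incident_edges_def)
    finally show ?thesis using cx[OF that] by (simp add: card_incident_edges)
  qed
  \<comment> \<open>Add the eigenvalue equations at \<open>u\<close> and \<open>v\<close>: every
    edge sum occurring in them is at most \<open>?y e\<close> in absolute value.\<close>
  have "c * ?y e = \<bar>c * x u + c * x v\<bar>"
    using uv c by (simp add: abs_mult flip: distrib_left)
  also have "\<dots> \<le> real (vdegree G u + vdegree G v) * ?y e"
    using bound[OF uv(1)] bound[OF uv(2)] by (simp add: algebra_simps)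
  finally have "c \<le> real (vdegree G u + vdegree G v)" using pos by simp
  with e uv show thesis by (intro that) auto
qed

text \<open>At a zero of a nonnegative eigenfunction the nonnegative edge sums add up to zero, so
  each of them vanishes. This replaces the Perron-Frobenius theorem.\<close>

lemma eigenfunction_zero_spreads:
  assumes G: "simple_graph G" and eig: "q_eigenfunction G c x" and nonneg: "\<And>v. x v \<ge> 0"
    and uv: "{u, v} \<in> edges G" and u: "x u = 0"
  shows "x v = 0"
proof -
  note adj = simple_graph_adjacent[OF G uv]
  have "(\<Sum>e\<in>incident_edges G u. sum x e) = 0"
    using eig adj u by (simp add: q_eigenfunction_def)
  then have "\<forall>e\<in>incident_edges G u. sum x e = 0"
    by (subst (asm) sum_nonneg_eq_0_iff) (auto simp: finite_incident_edges[OF G] nonneg sum_nonneg)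
  then have "sum x {u, v} = 0" using uv by (auto simp: incident_edges_def)
  then show ?thesis using adj u by simp
qed

section \<open>Shortest odd cycles\<close>

text \<open>Its power \<open>adj_rel G ^^ n\<close> relates the ends of walks of length
  \<open>n\<close>, with repeated vertices allowed.\<close>

definition adj_rel :: "'a ugraph \<Rightarrow> ('a \<times> 'a) set" where
  "adj_rel G = {(u, v). {u, v} \<in> edges G}"

definition cycle_edges :: "(nat \<Rightarrow> 'a) \<Rightarrow> nat \<Rightarrow> 'a set set" where
  "cycle_edges f g = (\<lambda>i. {f i, f (Suc i mod g)}) ` {..<g}"

lemma adj_rel_power_sym:
  "(u, v) \<in> adj_rel G ^^ n \<Longrightarrow> (v, u) \<in> adj_rel G ^^ n"
proof (induction n arbitrary: v)
  case (Suc n)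
  then obtain w where "(u, w) \<in> adj_rel G ^^ n" "(w, v) \<in> adj_rel G" by auto
  with Suc.IH show ?case
    by (intro relpow_Suc_I2[of v w]) (auto simp: adj_rel_def insert_commute)
qed auto

text \<open>Colour each vertex by the parity of a walk from a representative \<open>r v\<close> of
  its component. An edge joining two vertices of equal parity would close up an odd walk.\<close>

lemma bipartite_if_no_odd_closed_walk:
  assumes G: "simple_graph G" and no: "\<And>n u. odd n \<Longrightarrow> (u, u) \<notin> adj_rel G ^^ n"
  shows "bipartite_graph G"
proof -
  let ?R = "adj_rel G"
  define r where "r v = (SOME u. (v, u) \<in> ?R\<^sup>*)" for v
  have r: "(v, r v) \<in> ?R\<^sup>*" for v
    unfolding r_def by (rule someI[of _ v]) simp
  \<comment> \<open>Adjacent vertices reach the same vertices, so the choice operator is applied to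
    equal predicates.\<close>
  have r_eq: "r a = r b" if "(a, b) \<in> ?R" for a b
  proof -
    have "(b, a) \<in> ?R" using that by (simp add: adj_rel_def insert_commute)
    with that have "(\<lambda>u. (a, u) \<in> ?R\<^sup>*) = (\<lambda>u. (b, u) \<in> ?R\<^sup>*)"
      by (auto intro: converse_rtrancl_into_rtrancl)
    then show ?thesis by (simp add: r_def)
  qed
  have walk: "\<exists>n. (r v, v) \<in> ?R ^^ n" for v
  proof -
    obtain n where "(v, r v) \<in> ?R ^^ n" using rtrancl_imp_relpow[OF r[of v]] by blast
    then have "(r v, v) \<in> ?R ^^ n" by (rule adj_rel_power_sym)
    then show ?thesis ..
  qed
  have parity: "odd (n + m)" if "(a, b) \<in> ?R" "(r a, a) \<in> ?R ^^ n" "(r b, b) \<in> ?R ^^ m" for a b n m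
  proof -
    have "(r a, b) \<in> ?R ^^ Suc n" using that(1,2) by auto
    moreover have "(b, r a) \<in> ?R ^^ m"
      using adj_rel_power_sym[OF that(3)] r_eq[OF that(1)] by simp
    ultimately have "(r a, r a) \<in> ?R ^^ (Suc n + m)" by (rule relpow_trans)
    then have "\<not> odd (Suc n + m)" using no by blast
    then show ?thesis by simp
  qed
  define X where "X = {v \<in> verts G. \<exists>n. even n \<and> (r v, v) \<in> ?R ^^ n}"
  have "\<exists>x\<in>X. \<exists>y\<in>verts G - X. e = {x, y}" if e: "e \<in> edges G" for e
  proof -
    obtain a b where ab: "a \<in> verts G" "b \<in> verts G" "e = {a, b}"
      using simple_graph_edgeD[OF G e] by metis
    then have R: "(a, b) \<in> ?R" using e by (simp add: adj_rel_def)
    obtain n m where nm: "(r a, a) \<in> ?R ^^ n" "(r b, b) \<in> ?R ^^ m" using walk by blast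
    then have odd_nm: "odd (n + m)" using parity[OF R] by blast
    show ?thesis
    proof (cases "even n")
      case True
      then have "a \<in> X" using ab nm by (auto simp: X_def)
      moreover have "b \<notin> X"
        using parity[OF R nm(1)] True by (auto simp: X_def)
      ultimately show ?thesis using ab by auto
    next
      case False
      then have "b \<in> X" using ab nm odd_nm by (auto simp: X_def)
      moreover have "a \<notin> X"
        using parity[OF R _ nm(2)] False odd_nm by (auto simp: X_def)
      ultimately show ?thesis using ab by auto
    qed
  qed
  then show ?thesis
    unfolding bipartite_graph_def
    by (intro exI[of _ X] exI[of _ "verts G - X"]) (auto simp: X_def)
qed

section \<open>Cycles as injective vertex sequences\<close>

lemma Suc_mod_less: "i < g \<Longrightarrow> Suc i mod g = (if Suc i = g then 0 else Suc i)"
  by (simp add: mod_Suc)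

lemma cycle_edgesI: "i < g \<Longrightarrow> {f i, f (Suc i mod g)} \<in> cycle_edges f g"
  by (simp add: cycle_edges_def)

lemma finite_cycle_edges: "finite (cycle_edges f g)"
  by (simp add: cycle_edges_def)

text \<open>Two different indices with the same edge would be cyclic successors of each other, which
  is impossible for \<open>g \<ge> 3\<close>.\<close>

lemma inj_on_cycle_edge:
  assumes "inj_on f {..<g}" "g \<ge> 3"
  shows "inj_on (\<lambda>i. {f i, f (Suc i mod g)}) {..<g}"
proof (rule inj_onI)
  fix i j assume i: "i \<in> {..<g}" and j: "j \<in> {..<g}"
    and eq: "{f i, f (Suc i mod g)} = {f j, f (Suc j mod g)}"
  have "Suc i mod g < g" "Suc j mod g < g" using assms by auto
  with eq i j assms(1) have "i = j \<or> i = Suc j mod g \<and> Suc i mod g = j"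
    by (auto simp: doubleton_eq_iff inj_on_eq_iff)
  then show "i = j" using i j assms(2) by (auto simp: Suc_mod_less split: if_splits)
qed

lemma card_cycle_edges:
  "inj_on f {..<g} \<Longrightarrow> g \<ge> 3 \<Longrightarrow> card (cycle_edges f g) = g"
  unfolding cycle_edges_def by (simp add: card_image inj_on_cycle_edge)

lemma cycle_edges_subset: "e \<in> cycle_edges f g \<Longrightarrow> e \<subseteq> f ` {..<g}"
  by (auto simp: cycle_edges_def)

lemma card_cycle_edges_at:
  assumes "inj_on f {..<g}"
  shows "card {e \<in> cycle_edges f g. u \<in> e} \<le> 2"
proof (cases "u \<in> f ` {..<g}")
  case True
  then obtain j where j: "j < g" "u = f j" by auto
  let ?E = "\<lambda>i. {f i, f (Suc i mod g)}"
  \<comment> \<open>Only the edges with index \<open>j\<close> and with the cyclic predecessor of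
    \<open>j\<close> contain \<open>f j\<close>.\<close>
  have "{e \<in> cycle_edges f g. u \<in> e} \<subseteq> {?E j, ?E (if j = 0 then g - 1 else j - 1)}"
  proof
    fix e assume "e \<in> {e \<in> cycle_edges f g. u \<in> e}"
    then obtain i where i: "i < g" "e = ?E i" "f j = f i \<or> f j = f (Suc i mod g)"
      using j by (auto simp: cycle_edges_def)
    moreover have "Suc i mod g < g" using i by auto
    ultimately have "j = i \<or> j = Suc i mod g"
      using assms j by (auto simp: inj_on_eq_iff)
    then have "i = j \<or> i = (if j = 0 then g - 1 else j - 1)"
      using i(1) by (auto simp: Suc_mod_less split: if_splits)
    with i(2) show "e \<in> {?E j, ?E (if j = 0 then g - 1 else j - 1)}" by blast
  qed
  then have "card {e \<in> cycle_edges f g. u \<in> e} \<le> card {?E j, ?E (if j = 0 then g - 1 else j - 1)}"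
    by (intro card_mono) auto
  also have "\<dots> \<le> 2" by (simp add: card_insert_if)
  finally show ?thesis .
next
  case False
  then have "{e \<in> cycle_edges f g. u \<in> e} = {}" using cycle_edges_subset[of _ f g] by blast
  then show ?thesis by (metis card.empty zero_le)
qed

text \<open>Shifting the index cyclically moves any chosen vertex of the cycle to position
  0.\<close>

lemma cycle_rotate:
  assumes inj: "inj_on f {..<g}" and u: "u \<in> f ` {..<g}"
  obtains f' where "inj_on f' {..<g}" "f' 0 = u" "cycle_edges f' g = cycle_edges f g"
    "f' ` {..<g} = f ` {..<g}"
proof -
  obtain j where j: "j < g" "u = f j" using u by auto
  let ?s = "\<lambda>t. (j + t) mod g"
  have inj_s: "inj_on ?s {..<g}"
  proof (rule inj_onI)
    fix a b assume ab: "a \<in> {..<g}" "b \<in> {..<g}" "?s a = ?s b"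
    have "?s t = (if j + t < g then j + t else j + t - g)" if "t < g" for t
      using that j(1) by (simp add: le_mod_geq)
    with ab show "a = b" by (auto split: if_splits)
  qed
  have image_s: "?s ` {..<g} = {..<g}"
    using inj_s j(1) by (intro card_subset_eq) (auto simp: card_image)
  let ?f = "\<lambda>t. f (?s t)"
  have "?f ` {..<g} = f ` {..<g}" using image_s by (metis image_image)
  moreover have "inj_on ?f {..<g}"
    using comp_inj_on[OF inj_s, of f] inj image_s by (simp add: comp_def)
  moreover have "cycle_edges ?f g = cycle_edges f g"
  proof -
    have "(j + Suc t mod g) mod g = Suc (?s t) mod g" for t by (simp add: mod_simps)
    then have "cycle_edges ?f g = (\<lambda>i. {f i, f (Suc i mod g)}) ` ?s ` {..<g}"
      by (simp add: cycle_edges_def image_image)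
    then show ?thesis by (simp add: image_s cycle_edges_def)
  qed
  ultimately show thesis using j by (intro that[of ?f]) auto
qed

text \<open>A shortest odd closed walk is taken. Two positions split it into arcs of different
  parity: a repeated vertex would make the odd arc a shorter odd closed walk, and a chord would
  close the even arc to one. The last clause bounds all odd closed walks and later excludes
  triangles.\<close>

lemma shortest_odd_cycle:
  assumes G: "simple_graph G" and nb: "\<not> bipartite_graph G"
  obtains f g where "odd g" "g \<ge> 3" "inj_on f {..<g}" "cycle_edges f g \<subseteq> edges G"
    "f ` {..<g} \<subseteq> verts G"
    "\<forall>a\<in>f ` {..<g}. \<forall>b\<in>f ` {..<g}. {a, b} \<in> edges G \<longrightarrow> {a, b} \<in> cycle_edges f g"
    "\<forall>n u. odd n \<longrightarrow> (u, u) \<in> adj_rel G ^^ n \<longrightarrow> g \<le> n"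
proof -
  let ?R = "adj_rel G"
  let ?P = "\<lambda>n. odd n \<and> (\<exists>u. (u, u) \<in> ?R ^^ n)"
  define g where "g = (LEAST n. ?P n)"
  have "\<exists>n. ?P n" using bipartite_if_no_odd_closed_walk[OF G] nb by blast
  then have Pg: "?P g" unfolding g_def by (rule LeastI_ex)
  have min: "g \<le> n" if "odd n" "(u, u) \<in> ?R ^^ n" for n u
    unfolding g_def using that by (intro Least_le) blast
  have no_loop: "{x} \<notin> edges G" for x using simple_graph_adjacent(1)[OF G, of x x] by auto
  have "g \<noteq> 1" using Pg no_loop by (auto simp: adj_rel_def)
  then have g3: "g \<ge> 3" using Pg by (cases g; auto elim: oddE)
  from Pg obtain u where "(u, u) \<in> ?R ^^ g" by blast
  then obtain f where f01: "f 0 = u" "f g = u" "\<forall>i<g. (f i, f (Suc i)) \<in> ?R"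
    unfolding relpow_fun_conv by blast
  then have f: "f 0 = f g" "\<And>i. i < g \<Longrightarrow> (f i, f (Suc i)) \<in> ?R" by auto
  \<comment> \<open>The two arcs between \<open>f i\<close> and \<open>f j\<close> are walks of
    lengths \<open>j - i\<close> and \<open>g - j + i\<close>, whose sum is the odd number
    \<open>g\<close>.\<close>
  have seg: "(f i, f j) \<in> ?R ^^ (j - i)" if "i \<le> j" "j \<le> g" for i j
    unfolding relpow_fun_conv using that f(2) by (intro exI[of _ "\<lambda>t. f (i + t)"]) auto
  have around: "(f j, f i) \<in> ?R ^^ (g - j + i)" if "i \<le> j" "j \<le> g" for i j
  proof -
    have "(f j, f 0) \<in> ?R ^^ (g - j)" using seg[of j g] that f(1) by simp
    moreover have "(f 0, f i) \<in> ?R ^^ i" using seg[of 0 i] that by simp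
    ultimately show ?thesis by (rule relpow_trans)
  qed
  have neq: "f i \<noteq> f j" if "i < j" "j < g" for i j
  proof
    assume eq: "f i = f j"
    have "odd (j - i) \<or> odd (g - j + i)" using Pg that by auto
    moreover have "(f i, f i) \<in> ?R ^^ (j - i)" "(f i, f i) \<in> ?R ^^ (g - j + i)"
      using seg[of i j] around[of i j] eq that by auto
    ultimately have "g \<le> j - i \<or> g \<le> g - j + i" using min by blast
    then show False using that by linarith
  qed
  have inj: "inj_on f {..<g}"
    by (rule linorder_inj_onI) (use neq in auto)
  have fSuc: "f (Suc i mod g) = f (Suc i)" if "i < g" for i
    using that f(1) by (simp add: Suc_mod_less)
  have sub: "cycle_edges f g \<subseteq> edges G"
    using f(2) fSuc by (auto simp: cycle_edges_def adj_rel_def)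
  have "f i \<in> verts G" if "i < g" for i
    using f(2)[OF that] simple_graph_adjacent(2)[OF G] by (auto simp: adj_rel_def)
  then have sub_verts: "f ` {..<g} \<subseteq> verts G" by auto
  have chord: "{f i, f j} \<in> cycle_edges f g" if ij: "i < j" "j < g" and e: "{f i, f j} \<in> edges G" for i j
  proof -
    have R: "(f i, f j) \<in> ?R" "(f j, f i) \<in> ?R" using e by (auto simp: adj_rel_def insert_commute)
    have "(f i, f i) \<in> ?R ^^ Suc (j - i)" using seg[of i j] ij R by (auto intro: relpow_Suc_I)
    moreover have "(f j, f j) \<in> ?R ^^ Suc (g - j + i)"
      using around[of i j] ij R by (auto intro: relpow_Suc_I)
    moreover have "odd (Suc (j - i)) \<or> odd (Suc (g - j + i))" using Pg ij by auto
    ultimately have "g \<le> Suc (j - i) \<or> g \<le> Suc (g - j + i)" using min by blast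
    \<comment> \<open>One arc has length at least \<open>g - 1\<close>, so the positions are
      cyclically consecutive.\<close>
    then consider "j = Suc i" | "i = 0" "j = g - 1" using ij by linarith
    then show ?thesis
    proof cases
      case 1
      then have "{f i, f j} = {f i, f (Suc i mod g)}" using ij by (simp add: Suc_mod_less)
      also have "\<dots> \<in> cycle_edges f g" using ij by (intro cycle_edgesI) simp
      finally show ?thesis .
    next
      case 2
      then have "Suc j = g" using ij by linarith
      then have "Suc j mod g = i" using 2 by simp
      then have "{f i, f j} = {f j, f (Suc j mod g)}" by (simp only: insert_commute)
      also have "\<dots> \<in> cycle_edges f g" using ij by (intro cycle_edgesI)
      finally show ?thesis .
    qed
  qed
  have cycle_edge: "{a, b} \<in> cycle_edges f g"
    if ab: "a \<in> f ` {..<g}" "b \<in> f ` {..<g}" and e: "{a, b} \<in> edges G" for a b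
  proof -
    obtain i j where ij: "i < g" "j < g" "a = f i" "b = f j" using ab by blast
    then have "i \<noteq> j" using simple_graph_adjacent(1)[OF G e] by auto
    then show ?thesis using chord[of i j] chord[of j i] ij e
      by (metis insert_commute linorder_neqE_nat)
  qed
  show thesis
    by (rule that[of g f]) (use Pg g3 inj sub sub_verts min cycle_edge in \<open>simp_all (no_asm_simp)\<close>)
qed

text \<open>Exactly \<open>d(u) + d(v) - 1\<close> edges meet \<open>{u, v}\<close>. At most three
  of them lie on the cycle, so inclusion-exclusion bounds their union with the cycle. Equality
  leaves no edge outside this union and forces three common edges, hence both ends on the
  cycle.\<close>

lemma edge_degree_sum_bound:
  assumes G: "simple_graph G" and inj: "inj_on f {..<g}" and g: "g \<ge> 3"
    and sub: "cycle_edges f g \<subseteq> edges G"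
    and chordless: "\<forall>a\<in>f ` {..<g}. \<forall>b\<in>f ` {..<g}. {a, b} \<in> edges G \<longrightarrow> {a, b} \<in> cycle_edges f g"
    and uv: "{u, v} \<in> edges G"
  shows "vdegree G u + vdegree G v + g \<le> card (edges G) + 4"
    and "vdegree G u + vdegree G v + g = card (edges G) + 4 \<Longrightarrow>
      u \<in> f ` {..<g} \<and> v \<in> f ` {..<g} \<and> edges G = cycle_edges f g \<union> incident_edges G u \<union> incident_edges G v"
proof -
  let ?C = "cycle_edges f g"
  let ?I = "incident_edges G u \<union> incident_edges G v"
  let ?A = "{e \<in> ?C. u \<in> e}" and ?B = "{e \<in> ?C. v \<in> e}"
  note fin = simple_graph_finite_edges[OF G] finite_cycle_edges[of f g]
  have "u \<noteq> v" using simple_graph_adjacent(1)[OF G uv] .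
  have "incident_edges G u \<inter> incident_edges G v = {{u, v}}"
  proof
    show "incident_edges G u \<inter> incident_edges G v \<subseteq> {{u, v}}"
    proof
      fix e assume "e \<in> incident_edges G u \<inter> incident_edges G v"
      then have e: "e \<in> edges G" "u \<in> e" "v \<in> e" by (auto simp: incident_edges_def)
      obtain a b where "e = {a, b}" using simple_graph_edgeD[OF G e(1)] by metis
      with e \<open>u \<noteq> v\<close> show "e \<in> {{u, v}}" by auto
    qed
  qed (use uv in \<open>auto simp: incident_edges_def\<close>)
  then have I: "vdegree G u + vdegree G v = card ?I + 1"
    using card_Un_Int[OF finite_incident_edges[OF G, of u] finite_incident_edges[OF G, of v]]
    by (simp add: card_incident_edges)
  have CI: "card ?C + card ?I = card (?C \<union> ?I) + card (?A \<union> ?B)"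
  proof -
    have "?C \<inter> ?I = ?A \<union> ?B" using sub by (auto simp: incident_edges_def)
    then show ?thesis
      using card_Un_Int[of ?C ?I] fin finite_incident_edges[OF G] by simp
  qed
  have UnE: "?C \<union> ?I \<subseteq> edges G" using sub by (auto simp: incident_edges_def)
  then have le: "card (?C \<union> ?I) \<le> card (edges G)" using fin by (intro card_mono)
  have A2: "card ?A \<le> 2" and B2: "card ?B \<le> 2" using card_cycle_edges_at[OF inj] by auto
  have AB: "card (?A \<union> ?B) + card (?A \<inter> ?B) = card ?A + card ?B"
    using card_Un_Int[of ?A ?B] fin by simp
  have off: "card (?A \<union> ?B) \<le> 2" if "\<not> (u \<in> f ` {..<g} \<and> v \<in> f ` {..<g})"
  proof -
    have "?A = {} \<or> ?B = {}" using that cycle_edges_subset[of _ f g] by blast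
    then show ?thesis using A2 B2 by (metis sup_bot_left sup_bot_right)
  qed
  \<comment> \<open>With both ends on the cycle, chordlessness makes \<open>{u, v}\<close> a cycle
    edge. It is counted at both ends, so at most \<open>2 + 2 - 1\<close> cycle edges meet
    them.\<close>
  have on: "card (?A \<union> ?B) \<le> 3" if "u \<in> f ` {..<g} \<and> v \<in> f ` {..<g}"
  proof -
    have "{u, v} \<in> ?C" by (rule chordless[rule_format, OF conjunct1[OF that] conjunct2[OF that] uv])
    then have "{u, v} \<in> ?A \<inter> ?B" by simp
    moreover have "finite (?A \<inter> ?B)" using fin by simp
    ultimately have "card (?A \<inter> ?B) \<ge> 1" by (metis card_gt_0_iff empty_iff less_eq_Suc_le One_nat_def)
    then show ?thesis using AB A2 B2 by linarith
  qed
  have C: "card ?C = g" using card_cycle_edges[OF inj g] .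
  have AB3: "card (?A \<union> ?B) \<le> 3" using on off by fastforce
  show "vdegree G u + vdegree G v + g \<le> card (edges G) + 4"
    using I CI le AB3 C by linarith
  assume eq: "vdegree G u + vdegree G v + g = card (edges G) + 4"
  then have "card (?A \<union> ?B) \<ge> 3" "card (?C \<union> ?I) = card (edges G)"
    using I CI le AB3 C by linarith+
  then have "?C \<union> ?I = edges G" using card_subset_eq[OF _ UnE] fin by blast
  moreover have "u \<in> f ` {..<g} \<and> v \<in> f ` {..<g}"
    using off \<open>card (?A \<union> ?B) \<ge> 3\<close> by linarith
  ultimately show "u \<in> f ` {..<g} \<and> v \<in> f ` {..<g} \<and>
      edges G = cycle_edges f g \<union> incident_edges G u \<union> incident_edges G v" by (simp add: Un_assoc)
qed

section \<open>Cycles with pendant edges\<close>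

text \<open>The map \<open>h\<close> sends each pendant vertex to its neighbour. Varying
  \<open>h\<close> alone moves pendant edges while the vertex set stays fixed.\<close>

definition attach_pendants :: "(nat \<Rightarrow> 'a) \<Rightarrow> nat \<Rightarrow> 'a set \<Rightarrow> ('a \<Rightarrow> 'a) \<Rightarrow> 'a ugraph" where
  "attach_pendants f g P h =
     \<lparr>verts = f ` {..<g} \<union> P, edges = cycle_edges f g \<union> (\<lambda>p. {h p, p}) ` P\<rparr>"

lemma verts_attach_pendants [simp]: "verts (attach_pendants f g P h) = f ` {..<g} \<union> P"
  by (simp add: attach_pendants_def)

lemma edges_attach_pendants:
  "edges (attach_pendants f g P h) = cycle_edges f g \<union> (\<lambda>p. {h p, p}) ` P"
  by (simp add: attach_pendants_def)

locale cycle_with_leaves =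
  fixes f :: "nat \<Rightarrow> 'a" and g :: nat and P :: "'a set"
  assumes inj: "inj_on f {..<g}" and g3: "g \<ge> 3"
    and finP: "finite P" and disj: "P \<inter> f ` {..<g} = {}"
begin

lemma cycle_ends_distinct:
  assumes "i < g" shows "f i \<noteq> f (Suc i mod g)"
proof -
  have "Suc i mod g < g" "i \<noteq> Suc i mod g" using assms g3 by (auto simp: Suc_mod_less)
  then show ?thesis using inj assms by (auto simp: inj_on_eq_iff)
qed

lemma leaf_neq: "p \<in> P \<Longrightarrow> c \<in> f ` {..<g} \<Longrightarrow> c \<noteq> p"
  using disj by blast

lemma simple_graph_attach:
  assumes h: "h ` P \<subseteq> f ` {..<g}"
  shows "simple_graph (attach_pendants f g P h)"
  unfolding simple_graph_def
proof (intro conjI ballI)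
  show "finite (verts (attach_pendants f g P h))" using finP by simp
  fix e assume "e \<in> edges (attach_pendants f g P h)"
  then consider i where "i < g" "e = {f i, f (Suc i mod g)}" | p where "p \<in> P" "e = {h p, p}"
    by (auto simp: edges_attach_pendants cycle_edges_def)
  then show "\<exists>u\<in>verts (attach_pendants f g P h). \<exists>v\<in>verts (attach_pendants f g P h). u \<noteq> v \<and> e = {u, v}"
  proof cases
    case 1
    moreover have "Suc i mod g < g" using g3 by simp
    ultimately show ?thesis using cycle_ends_distinct
      by (intro bexI[of _ "f i"] bexI[of _ "f (Suc i mod g)"]) auto
  next
    case 2
    then have "h p \<in> f ` {..<g}" using h by blast
    then show ?thesis using 2 disj by (intro bexI[of _ "h p"] bexI[of _ p]) auto
  qed
qed

text \<open>A pendant edge contains a leaf, which no cycle edge does, and it is determined by that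
  leaf. The summand is arbitrary because edge count, quadratic form and vertex sums all use this
  splitting.\<close>

lemma sum_edges_attach:
  fixes F :: "'a set \<Rightarrow> 'b :: comm_monoid_add"
  assumes h: "h ` P \<subseteq> f ` {..<g}"
  shows "sum F (edges (attach_pendants f g P h)) = sum F (cycle_edges f g) + (\<Sum>p\<in>P. F {h p, p})"
proof -
  have "cycle_edges f g \<inter> (\<lambda>p. {h p, p}) ` P = {}"
  proof -
    have False if "{h p, p} \<in> cycle_edges f g" "p \<in> P" for p
      using cycle_edges_subset[OF that(1)] that(2) disj by blast
    then show ?thesis by blast
  qed
  moreover have "inj_on (\<lambda>p. {h p, p}) P"
  proof (rule inj_onI)
    fix p q assume pq: "p \<in> P" "q \<in> P" "{h p, p} = {h q, q}"
    then have "p \<noteq> h q" using leaf_neq[of p "h q"] h by (simp add: image_subset_iff)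
    then show "p = q" using pq by (auto simp: doubleton_eq_iff)
  qed
  ultimately show ?thesis
    using finP by (simp add: edges_attach_pendants sum.union_disjoint finite_cycle_edges sum.reindex)
qed

lemma card_edges_attach:
  assumes "h ` P \<subseteq> f ` {..<g}"
  shows "card (edges (attach_pendants f g P h)) = g + card P"
  using sum_edges_attach[OF assms, of "\<lambda>_. 1 :: nat"] card_cycle_edges[OF inj g3] by simp

lemma q_form_attach:
  assumes h: "h ` P \<subseteq> f ` {..<g}"
  shows "q_form (attach_pendants f g P h) x =
    (\<Sum>e\<in>cycle_edges f g. (sum x e)\<^sup>2) + (\<Sum>p\<in>P. (x (h p) + x p)\<^sup>2)"
proof -
  have "sum x {h p, p} = x (h p) + x p" if "p \<in> P" for p
  proof -
    have "h p \<noteq> p" using leaf_neq[OF that] h that by (simp add: image_subset_iff)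
    then show ?thesis by simp
  qed
  then show ?thesis unfolding q_form_def sum_edges_attach[OF h] by simp
qed

text \<open>The cycle part does not depend on \<open>h\<close>, so it cancels when two attachments
  are compared at the same vertex.\<close>

lemma sum_incident_attach:
  fixes x :: "'a \<Rightarrow> real"
  assumes h: "h ` P \<subseteq> f ` {..<g}" and b: "b \<in> f ` {..<g}"
  shows "(\<Sum>e\<in>incident_edges (attach_pendants f g P h) b. sum x e) =
    (\<Sum>e\<in>cycle_edges f g. if b \<in> e then sum x e else 0) + (\<Sum>p\<in>P. if h p = b then x b + x p else 0)"
proof -
  let ?G = "attach_pendants f g P h"
  have "(\<Sum>e\<in>incident_edges ?G b. sum x e) = (\<Sum>e\<in>edges ?G. if b \<in> e then sum x e else 0)"
    unfolding incident_edges_def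
    by (rule sum.inter_filter) (rule simple_graph_finite_edges[OF simple_graph_attach[OF h]])
  also have "\<dots> = (\<Sum>e\<in>cycle_edges f g. if b \<in> e then sum x e else 0) +
      (\<Sum>p\<in>P. if b \<in> {h p, p} then sum x {h p, p} else 0)"
    by (rule sum_edges_attach[OF h])
  also have "(\<Sum>p\<in>P. if b \<in> {h p, p} then sum x {h p, p} else 0) =
      (\<Sum>p\<in>P. if h p = b then x b + x p else 0)"
  proof (rule sum.cong[OF refl])
    fix p assume "p \<in> P"
    then have "h p \<noteq> p" "b \<noteq> p" using leaf_neq b h by (simp_all add: image_subset_iff)
    then show "(if b \<in> {h p, p} then sum x {h p, p} else 0) = (if h p = b then x b + x p else 0)"
      by auto
  qed
  finally show ?thesis .
qed

text \<open>With the zero rotated to position 0, it spreads round the cycle by induction and then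
  along the pendant edges.\<close>

lemma eigenfunction_zero_on_attach:
  assumes h: "h ` P \<subseteq> f ` {..<g}" and eig: "q_eigenfunction (attach_pendants f g P h) c x"
    and nonneg: "\<And>v. x v \<ge> 0" and b: "b \<in> f ` {..<g}" "x b = 0"
  shows "norm_sq (attach_pendants f g P h) x = 0"
proof -
  let ?G = "attach_pendants f g P h"
  note spread = eigenfunction_zero_spreads[OF simple_graph_attach[OF h] eig nonneg]
  obtain f' where f': "f' 0 = b" "cycle_edges f' g = cycle_edges f g" "f' ` {..<g} = f ` {..<g}"
    using cycle_rotate[OF inj b(1)] by metis
  have "x (f' i) = 0" if "i < g" for i
    using that
  proof (induction i)
    case (Suc i)
    have "{f' i, f' (Suc i mod g)} \<in> edges ?G"
      using Suc.prems cycle_edgesI[of i g f'] f'(2) by (simp add: edges_attach_pendants)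
    then have "{f' i, f' (Suc i)} \<in> edges ?G" using Suc.prems by simp
    then show ?case using spread Suc by simp
  qed (simp add: f' b)
  then have C: "x v = 0" if "v \<in> f ` {..<g}" for v using that f'(3) by force
  have "x p = 0" if "p \<in> P" for p
  proof -
    have "{h p, p} \<in> edges ?G" "x (h p) = 0"
      using that h C by (auto simp: edges_attach_pendants)
    then show ?thesis by (rule spread)
  qed
  with C show ?thesis by (auto simp: norm_sq_def intro!: sum.neutral)
qed

text \<open>Moving all pendant edges to the end where the Perron vector is larger increases the form. If
  the maximum stayed the same, the vector would be an eigenfunction of both graphs, and comparing
  the two equations at the other end would force it to vanish there.\<close>

lemma q_index_concentrate:
  assumes u: "u \<in> f ` {..<g}" and v: "v \<in> f ` {..<g}" and h: "h ` P \<subseteq> {u, v}"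
  obtains a where "a \<in> {u, v}"
    "q_index (attach_pendants f g P h) \<le> q_index (attach_pendants f g P (\<lambda>_. a))"
    "q_index (attach_pendants f g P h) = q_index (attach_pendants f g P (\<lambda>_. a)) \<Longrightarrow>
      \<forall>p\<in>P. h p = a"
proof -
  let ?G = "attach_pendants f g P h"
  have hC: "h ` P \<subseteq> f ` {..<g}" using h u v by blast
  note G = simple_graph_attach[OF hC]
  have ne: "verts (attach_pendants f g P k) \<noteq> {}" for k using u by auto
  obtain x where x: "\<And>v. x v \<ge> 0" "norm_sq ?G x > 0" "q_form ?G x = q_index ?G * norm_sq ?G x"
    using exists_nonneg_q_maximiser[OF G ne] by blast
  define a where "a = (if x u \<ge> x v then u else v)"
  have a: "a \<in> {u, v}" "x u \<le> x a" "x v \<le> x a" by (auto simp: a_def)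
  let ?H = "attach_pendants f g P (\<lambda>_. a)"
  have aC: "(\<lambda>_. a) ` P \<subseteq> f ` {..<g}" using a u v by auto
  note H = simple_graph_attach[OF aC]
  have norm: "norm_sq ?H x = norm_sq ?G x" by (simp add: norm_sq_def)
  have form: "q_form ?G x \<le> q_form ?H x"
    unfolding q_form_attach[OF hC] q_form_attach[OF aC]
  proof (intro add_left_mono sum_mono)
    fix p assume "p \<in> P"
    then have "x (h p) \<le> x a" using h a by blast
    then show "(x (h p) + x p)\<^sup>2 \<le> (x a + x p)\<^sup>2" using x(1) by (intro power_mono) auto
  qed
  note le_H = q_form_le_q_index[OF H ne, of x]
  have "q_index ?G * norm_sq ?G x \<le> q_index ?H * norm_sq ?G x"
    using form le_H x(3) norm by simp
  then have le: "q_index ?G \<le> q_index ?H" using x(2) by simp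
  have "\<forall>p\<in>P. h p = a" if eq: "q_index ?G = q_index ?H"
  proof (rule ccontr)
    assume "\<not> (\<forall>p\<in>P. h p = a)"
    then obtain p where p: "p \<in> P" "h p \<noteq> a" by blast
    define b where "b = h p"
    have b: "b \<in> f ` {..<g}" "b \<noteq> a" using p hC by (auto simp: b_def)
    have "q_form ?H x = q_index ?H * norm_sq ?H x" using form le_H x(3) norm eq by simp
    then have eigH: "q_eigenfunction ?H (q_index ?H) x"
      by (rule q_index_maximiser_eigenfunction[OF H ne])
    have eigG: "q_eigenfunction ?G (q_index ?G) x"
      using x(3) by (rule q_index_maximiser_eigenfunction[OF G ne])
    \<comment> \<open>Both equations have the same right side at \<open>b\<close>. Since
      \<open>b \<noteq> a\<close>, no pendant edge of \<open>?H\<close> is attached there, so the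
      pendant terms of \<open>?G\<close> at \<open>b\<close> must sum to zero.\<close>
    have "(\<Sum>e\<in>incident_edges ?G b. sum x e) = (\<Sum>e\<in>incident_edges ?H b. sum x e)"
      using eigG eigH b eq by (simp add: q_eigenfunction_def)
    then have "(\<Sum>p\<in>P. if h p = b then x b + x p else 0) = 0"
      using b by (simp add: sum_incident_attach[OF hC b(1)] sum_incident_attach[OF aC b(1)])
    then have "\<forall>p\<in>P. (if h p = b then x b + x p else 0) = 0"
      by (subst (asm) sum_nonneg_eq_0_iff) (auto simp: finP x(1))
    then have "x b + x p = 0" using p by (auto simp: b_def)
    then have "x b = 0" using x(1)[of b] x(1)[of p] by linarith
    then have "norm_sq ?G x = 0"
      using eigenfunction_zero_on_attach[OF hC eigG x(1) b(1)] by simp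
    with x(2) show False by simp
  qed
  with a(1) le show thesis by (rule that)
qed

end

section \<open>The extremal graph\<close>

lemma cycle_star_eq_attach_pendants:
  "g > 0 \<Longrightarrow> cycle_star g s = attach_pendants (\<lambda>i. i) g {g..<g + s} (\<lambda>_. 0)"
  by (auto simp: cycle_star_def attach_pendants_def cycle_graph_def star_graph_def cycle_edges_def)

lemma cycle_with_leaves_cycle_star: "g \<ge> 3 \<Longrightarrow> cycle_with_leaves (\<lambda>i. i) g {g..<g + s}"
  by unfold_locales auto

lemma simple_graph_cycle_star:
  assumes "g \<ge> 3" shows "simple_graph (cycle_star g s)"
proof -
  have "simple_graph (attach_pendants (\<lambda>i. i) g {g..<g + s} (\<lambda>_. 0))"
    using assms by (intro cycle_with_leaves.simple_graph_attach cycle_with_leaves_cycle_star) auto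
  then show ?thesis using assms by (simp add: cycle_star_eq_attach_pendants)
qed

text \<open>Rotate \<open>a\<close> to position 0 and match the leaves by any bijection. The map is
  built from the standard graph, whose numbering separates cycle and leaves, and then
  reversed.\<close>

lemma (in cycle_with_leaves) graph_iso_cycle_star:
  assumes a: "a \<in> f ` {..<g}"
  shows "graph_iso (attach_pendants f g P (\<lambda>_. a)) (cycle_star g (card P))"
proof (rule graph_iso_sym[OF simple_graph_cycle_star[OF g3]])
  obtain f' where f': "inj_on f' {..<g}" "f' 0 = a" "cycle_edges f' g = cycle_edges f g"
      "f' ` {..<g} = f ` {..<g}"
    using cycle_rotate[OF inj a] .
  let ?L = "{g..<g + card P}"
  obtain k where k: "bij_betw k ?L P"
    using finite_same_card_bij[of ?L P] finP by auto
  define m where "m i = (if i < g then f' i else k i)" for i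
  have g0: "g > 0" using g3 by simp
  have cyc: "bij_betw m {..<g} (f ` {..<g})"
    using f'(1,4) by (subst bij_betw_cong[of _ _ f']) (auto simp: m_def bij_betw_def)
  have leaves: "bij_betw m ?L P"
    using k by (subst bij_betw_cong[of _ _ k]) (auto simp: m_def)
  have "bij_betw m ({..<g} \<union> ?L) (f ` {..<g} \<union> P)"
    using disj by (intro bij_betw_combine[OF cyc leaves]) auto
  moreover have "(\<lambda>e. m ` e) ` edges (cycle_star g (card P)) =
      edges (attach_pendants f g P (\<lambda>_. a))"
  proof -
    have "(\<lambda>e. m ` e) ` cycle_edges (\<lambda>i. i) g = (\<lambda>i. {m i, m (Suc i mod g)}) ` {..<g}"
      by (simp add: cycle_edges_def image_image)
    also have "\<dots> = cycle_edges f' g"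
      unfolding cycle_edges_def by (rule image_cong) (auto simp: m_def g0)
    finally have 1: "(\<lambda>e. m ` e) ` cycle_edges (\<lambda>i. i) g = cycle_edges f g" using f'(3) by simp
    have "(\<lambda>e. m ` e) ` (\<lambda>p. {0, p}) ` ?L = (\<lambda>p. {a, p}) ` m ` ?L"
      using g0 f'(2) by (simp add: image_image m_def insert_commute)
    then have 2: "(\<lambda>e. m ` e) ` (\<lambda>p. {0, p}) ` ?L = (\<lambda>p. {a, p}) ` P"
      using bij_betw_imp_surj_on[OF leaves] by simp
    show ?thesis
      by (simp only: cycle_star_eq_attach_pendants[OF g0] edges_attach_pendants image_Un 1 2)
  qed
  ultimately show "graph_iso (cycle_star g (card P)) (attach_pendants f g P (\<lambda>_. a))"
    unfolding graph_iso_def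
    by (intro exI[of _ m]) (simp add: cycle_star_eq_attach_pendants[OF g0])
qed

text \<open>The test vector is the Perron vector of the star formed by the edges at \<open>0\<close>, whose
  \<open>Q\<close>-index is \<open>s + 3\<close>; the cycle edge \<open>{1, 2}\<close> makes the inequality strict.\<close>

lemma q_index_cycle_star_gt:
  assumes g: "g \<ge> 4"
  shows "q_index (cycle_star g s) > real s + 3"
proof -
  let ?G = "cycle_star g s" and ?L = "{g..<g + s}"
  interpret cycle_with_leaves "\<lambda>i. i" g ?L using g by (intro cycle_with_leaves_cycle_star) simp
  have g0: "g > 0" and z: "(\<lambda>_. 0) ` ?L \<subseteq> (\<lambda>i. i) ` {..<g}" using g by auto
  note Geq = cycle_star_eq_attach_pendants[OF g0, of s]
  have G: "simple_graph ?G" using g by (intro simple_graph_cycle_star) simp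
  have ne: "verts ?G \<noteq> {}" using g0 by (auto simp: Geq)
  \<comment> \<open>The centre 0 has \<open>s + 2\<close> neighbours, each with value 1; the
    condition \<open>i \<ge> g - 1\<close> covers the last cycle vertex together with all
    leaves.\<close>
  define x :: "nat \<Rightarrow> real" where
    "x i = (if i = 0 then real s + 2 else if i = 1 \<or> i \<ge> g - 1 then 1 else 0)" for i
  let ?c = "\<lambda>i. (x i + x (Suc i mod g))\<^sup>2"
  have "(\<Sum>e\<in>cycle_edges (\<lambda>i. i) g. (sum x e)\<^sup>2) = (\<Sum>i<g. (sum x {i, Suc i mod g})\<^sup>2)"
    unfolding cycle_edges_def by (rule sum.reindex[OF inj_on_cycle_edge[OF inj g3], unfolded comp_def])
  also have "\<dots> = (\<Sum>i<g. ?c i)"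
    using cycle_ends_distinct by (intro sum.cong) auto
  \<comment> \<open>Indices 0 and \<open>g - 1\<close> are the cycle edges at the centre. Index 1 is
    the edge \<open>{1, 2}\<close>, which contributes 1 because \<open>g \<ge> 4\<close> gives
    \<open>x 2 = 0\<close>.\<close>
  also have "\<dots> \<ge> (\<Sum>i\<in>{0, 1, g - 1}. ?c i)"
    using g by (intro sum_mono2) auto
  also have "(\<Sum>i\<in>{0, 1, g - 1}. ?c i) = 2 * (real s + 3)\<^sup>2 + 1"
    using g by (simp add: x_def Suc_mod_less algebra_simps)
  finally have cyc: "(\<Sum>e\<in>cycle_edges (\<lambda>i. i) g. (sum x e)\<^sup>2) \<ge> 2 * (real s + 3)\<^sup>2 + 1" .
  have "(\<Sum>p\<in>?L. (x 0 + x p)\<^sup>2) = (\<Sum>p\<in>?L. (real s + 3)\<^sup>2)"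
    using g by (intro sum.cong) (auto simp: x_def)
  then have form: "q_form ?G x \<ge> (real s + 2) * (real s + 3)\<^sup>2 + 1"
    using cyc by (simp add: Geq q_form_attach[OF z] algebra_simps)
  have "norm_sq ?G x = (\<Sum>i<g. (x i)\<^sup>2) + (\<Sum>i\<in>?L. (x i)\<^sup>2)"
    unfolding norm_sq_def Geq verts_attach_pendants image_ident
    by (rule sum.union_disjoint) auto
  also have "(\<Sum>i<g. (x i)\<^sup>2) = (\<Sum>i\<in>{0, 1, g - 1}. (x i)\<^sup>2)"
    using g by (intro sum.mono_neutral_right) (auto simp: x_def)
  also have "\<dots> = (real s + 2)\<^sup>2 + 2" using g by (simp add: x_def)
  also have "(\<Sum>i\<in>?L. (x i)\<^sup>2) = (\<Sum>i\<in>?L. 1)"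
    using g by (intro sum.cong) (auto simp: x_def)
  finally have norm: "norm_sq ?G x = (real s + 2) * (real s + 3)"
    by (simp add: power2_eq_square algebra_simps)
  have "(real s + 3) * norm_sq ?G x < q_form ?G x"
    using form by (simp add: norm power2_eq_square algebra_simps)
  also have "\<dots> \<le> q_index ?G * norm_sq ?G x" by (rule q_form_le_q_index[OF G ne])
  finally show ?thesis using norm by simp
qed

text \<open>A vertex off the cycle is not isolated, and its edges are not cycle edges, so it is
  adjacent to \<open>u\<close> or \<open>v\<close>; having no common neighbour makes this end
  unique.\<close>

lemma eq_attach_pendants_if_extremal:
  assumes G: "simple_graph G" and iso: "no_isolated_vertices G"
    and cyc: "f ` {..<g} \<subseteq> verts G" "cycle_edges f g \<subseteq> edges G"
    and chordless: "\<forall>a\<in>f ` {..<g}. \<forall>b\<in>f ` {..<g}. {a, b} \<in> edges G \<longrightarrow> {a, b} \<in> cycle_edges f g"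
    and triangle_free: "\<And>p. \<not> ({u, p} \<in> edges G \<and> {v, p} \<in> edges G)"
    and uv: "u \<in> f ` {..<g}" "v \<in> f ` {..<g}"
    and edges: "edges G = cycle_edges f g \<union> incident_edges G u \<union> incident_edges G v"
  shows "G = attach_pendants f g (verts G - f ` {..<g}) (\<lambda>p. if {u, p} \<in> edges G then u else v)"
    (is "G = attach_pendants f g ?P ?h")
proof -
  have at_ends: "u \<in> e \<or> v \<in> e" if "e \<in> edges G" "e \<notin> cycle_edges f g" for e
    using equalityD1[OF edges, THEN subsetD, OF that(1)] that(2) by (auto simp: incident_edges_def)
  have pendant: "{u, p} \<in> edges G \<or> {v, p} \<in> edges G" if p: "p \<in> ?P" for p
  proof -
    obtain e where e: "e \<in> edges G" "p \<in> e" using iso p by (auto simp: no_isolated_vertices_def)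
    moreover have "e \<notin> cycle_edges f g" using e(2) p cycle_edges_subset[of e f g] by blast
    ultimately have "u \<in> e \<or> v \<in> e" using at_ends by blast
    moreover obtain a b where "e = {a, b}" using simple_graph_edgeD[OF G e(1)] by metis
    moreover have "p \<noteq> u" "p \<noteq> v" using p uv by auto
    ultimately show ?thesis using e by (auto simp: insert_commute)
  qed
  have "edges G \<subseteq> cycle_edges f g \<union> (\<lambda>p. {?h p, p}) ` ?P"
  proof
    fix e assume e: "e \<in> edges G"
    show "e \<in> cycle_edges f g \<union> (\<lambda>p. {?h p, p}) ` ?P"
    proof (cases "e \<in> cycle_edges f g")
      case False
      then obtain w where w: "w \<in> {u, v}" "w \<in> e" using at_ends[OF e] by blast
      obtain a b where "e = {a, b}" using simple_graph_edgeD[OF G e] by metis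
      then obtain p where p: "e = {w, p}" using w(2) by (auto simp: insert_commute)
      have "p \<in> verts G" using simple_graph_adjacent(3)[OF G] e p by blast
      \<comment> \<open>Otherwise both ends of \<open>e\<close> lie on the cycle, and chordlessness
        makes \<open>e\<close> a cycle edge.\<close>
      moreover have "p \<notin> f ` {..<g}"
      proof
        assume pC: "p \<in> f ` {..<g}"
        have "w \<in> f ` {..<g}" using w(1) uv by (elim insertE) simp_all
        then have "e \<in> cycle_edges f g" using chordless[rule_format, OF _ pC] e p by simp
        with False show False ..
      qed
      moreover have "?h p = w" using w(1) e p triangle_free[of p] by auto
      ultimately show ?thesis using p by blast
    qed simp
  qed
  moreover have "{?h p, p} \<in> edges G" if "p \<in> ?P" for p using pendant[OF that] by auto
  ultimately have "edges G = edges (attach_pendants f g ?P ?h)"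
    using cyc(2) unfolding edges_attach_pendants by blast
  moreover have "verts G = verts (attach_pendants f g ?P ?h)" using cyc(1) by auto
  ultimately show ?thesis by simp
qed

theorem theorem1p3:
  fixes G :: "'a ugraph" and k m :: nat
  assumes "k \<ge> 1"
    and "simple_graph G"
    and "\<not> bipartite_graph G"
    and "card (edges G) = m"
    and "m \<ge> 2 * k + 3"
    and "no_isolated_vertices G"
    and "\<forall>i\<in>{1..k}. \<not> contains_subgraph G (cycle_graph (2 * i + 1))"
  shows "q_index G \<le> q_index (cycle_star (2 * k + 3) (m - (2 * k + 3))) \<and>
    (q_index G = q_index (cycle_star (2 * k + 3) (m - (2 * k + 3))) \<longleftrightarrow>
      graph_iso G (cycle_star (2 * k + 3) (m - (2 * k + 3))))"
proof -
  note G = \<open>simple_graph G\<close>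
  let ?l = "2 * k + 3"
  let ?s = "m - ?l"
  let ?H = "cycle_star ?l ?s"
  obtain f g where g: "odd g" "g \<ge> 3" and inj: "inj_on f {..<g}"
    and cyc: "cycle_edges f g \<subseteq> edges G" "f ` {..<g} \<subseteq> verts G"
    and chordless: "\<forall>a\<in>f ` {..<g}. \<forall>b\<in>f ` {..<g}. {a, b} \<in> edges G \<longrightarrow> {a, b} \<in> cycle_edges f g"
    and shortest: "\<forall>n u. odd n \<longrightarrow> (u, u) \<in> adj_rel G ^^ n \<longrightarrow> g \<le> n"
    using shortest_odd_cycle[OF G \<open>\<not> bipartite_graph G\<close>] .
  have "f 0 \<in> f ` {..<g}" using g(2) by (intro imageI) simp
  then have ne: "verts G \<noteq> {}" using cyc(2) by (metis empty_iff subsetD)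
  have "contains_subgraph G (cycle_graph g)"
    unfolding contains_subgraph_def
  proof (intro exI[of _ f] conjI ballI)
    fix e assume "e \<in> edges (cycle_graph g)"
    then have "f ` e \<in> cycle_edges f g" by (auto simp: cycle_graph_def cycle_edges_def)
    then show "f ` e \<in> edges G" using cyc by blast
  qed (use inj cyc in \<open>auto simp: cycle_graph_def\<close>)
  then have gl: "g \<ge> ?l"
  proof -
    obtain i where i: "g = 2 * i + 1" using g(1) by (auto elim: oddE)
    with \<open>contains_subgraph G (cycle_graph g)\<close> assms(7) have "i \<notin> {1..k}" by blast
    then show ?thesis using i g(2) by auto
  qed
  have iso_eq: "q_index G = q_index ?H" if "graph_iso G ?H"
    using q_index_iso[OF G ne that] .
  \<comment> \<open>If \<open>q_index G\<close> is strictly smaller, both claims hold, since an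
    isomorphism would force equality. Otherwise the structure of \<open>G\<close> is
    determined.\<close>
  show ?thesis
  proof (cases "q_index G < q_index ?H")
    case True
    then show ?thesis using iso_eq by auto
  next
    case False
    have big: "q_index G > real ?s + 3"
      using False q_index_cycle_star_gt[of ?l ?s] \<open>k \<ge> 1\<close> by linarith
    obtain x where x: "norm_sq G x > 0" "q_form G x = q_index G * norm_sq G x"
      using exists_nonneg_q_maximiser[OF G ne] by blast
    have nz: "\<exists>v\<in>verts G. x v \<noteq> 0"
      using x(1) norm_sq_pos_iff[OF simple_graph_finite_verts[OF G]] by blast
    have pos: "q_index G > 0" using big by linarith
    obtain u v where uv: "{u, v} \<in> edges G" "q_index G \<le> real (vdegree G u + vdegree G v)"
      using eigenvalue_le_edge_degree_sum[OF G q_index_maximiser_eigenfunction[OF G ne x(2)] nz pos] .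
    \<comment> \<open>Degrees are integers, so the degree sum is at least \<open>?s + 4\<close>.
      With the upper bound \<open>m - g + 4\<close> this gives \<open>g \<le> ?l\<close>, hence
      equality throughout.\<close>
    have "real (vdegree G u + vdegree G v) > real (?s + 3)" using uv(2) big by simp
    then have deg: "vdegree G u + vdegree G v > ?s + 3" by (simp only: of_nat_less_iff)
    note bound = edge_degree_sum_bound[OF G inj g(2) cyc(1) chordless uv(1)]
    have gl: "g = ?l" and eq: "vdegree G u + vdegree G v + g = card (edges G) + 4"
      using bound(1) deg gl assms(4,5) by linarith+
    have uvC: "u \<in> f ` {..<g}" "v \<in> f ` {..<g}"
      and edges: "edges G = cycle_edges f g \<union> incident_edges G u \<union> incident_edges G v"
      using bound(2)[OF eq] by blast+
    \<comment> \<open>A common neighbour would give a closed walk of length 3, whereas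
      \<open>g = 2 * k + 3\<close> is at least 5.\<close>
    have triangle_free: "\<not> ({u, p} \<in> edges G \<and> {v, p} \<in> edges G)" for p
    proof
      assume "{u, p} \<in> edges G \<and> {v, p} \<in> edges G"
      then have "(u, p) \<in> adj_rel G" "(p, v) \<in> adj_rel G" "(v, u) \<in> adj_rel G"
        using uv(1) by (auto simp: adj_rel_def insert_commute)
      then have "(u, u) \<in> adj_rel G ^^ 3" by (auto simp: numeral_3_eq_3)
      then have "g \<le> 3" using shortest[rule_format, of 3 u] by simp
      then show False using gl \<open>k \<ge> 1\<close> by simp
    qed
    define P where "P = verts G - f ` {..<g}"
    define h where "h p = (if {u, p} \<in> edges G then u else v)" for p
    have G_eq: "G = attach_pendants f g P h"
      unfolding P_def h_def
      using eq_attach_pendants_if_extremal[OF G assms(6) cyc(2,1) chordless triangle_free uvC edges] .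
    interpret cycle_with_leaves f g P
      using inj g simple_graph_finite_verts[OF G] by unfold_locales (auto simp: P_def)
    have hP: "h ` P \<subseteq> {u, v}" by (auto simp: h_def)
    then have "card (edges G) = g + card P"
      using card_edges_attach[of h] uvC unfolding G_eq[symmetric] by blast
    then have cardP: "card P = ?s" using assms(4) gl by simp
    obtain a where a: "a \<in> {u, v}" "q_index G \<le> q_index (attach_pendants f g P (\<lambda>_. a))"
      "q_index G = q_index (attach_pendants f g P (\<lambda>_. a)) \<Longrightarrow> \<forall>p\<in>P. h p = a"
      using q_index_concentrate[OF uvC hP] unfolding G_eq[symmetric] by blast
    have aC: "a \<in> f ` {..<g}" using a(1) uvC by blast
    have iso_a: "graph_iso (attach_pendants f g P (\<lambda>_. a)) ?H"
      using graph_iso_cycle_star[OF aC] by (simp only: cardP gl)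
    have "simple_graph (attach_pendants f g P (\<lambda>_. a))"
      using aC by (intro simple_graph_attach) auto
    then have q_a: "q_index (attach_pendants f g P (\<lambda>_. a)) = q_index ?H"
      using iso_a uvC by (intro q_index_iso) auto
    have "graph_iso G ?H" if "q_index G = q_index ?H"
    proof -
      have "\<forall>p\<in>P. h p = a" using a(3) that q_a by simp
      then have "(\<lambda>p. {h p, p}) ` P = (\<lambda>p. {a, p}) ` P" by (intro image_cong) auto
      then have "attach_pendants f g P h = attach_pendants f g P (\<lambda>_. a)"
        by (simp add: attach_pendants_def)
      then have "G = attach_pendants f g P (\<lambda>_. a)" using G_eq by (rule trans[rotated])
      then show ?thesis using iso_a by simp
    qed
    then show ?thesis using a(2) q_a iso_eq by auto
  qed
qed

end
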